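(* Let $A$ be a Vidinli algebra over a field $\mathbb{F}$ of characteristic not $2$, with norm $q$ and associated bilinear form $B$, and let $V=\{x\in A\mid q(x,1)=0\}$. Then either $B|_V=0$ (that is, $B(u,v)=0$ for all $u,v\in V$), or $\dim A=2$, or $Z(A)=N(A)=\mathbb{F}1$. In the first two cases, $A$ is commutative and associative, so its center and nucleus are the whole algebra.
   Context: Algebras are not necessarily associative: an algebra over a field $\mathbb{F}$ is a vector space with a bilinear multiplication (of arbitrary dimension). Write $[x,y]=xy-yx$. For a quadratic form $q$, its polar form is denoted by the same letter: $q(x,y)=q(x+y)-q(x)-q(y)$. A conic algebra is a unital algebra $A$ (unity $1$) endowed with a quadratic form $q\colon A\to\mathbb{F}$, called the norm, such that $q(1)=1$ and $x^2-q(x,1)x+q(x)1=0$ for all $x\in A$. A Vidinli algebra is a conic algebra $A$ such that $[A,A]\subseteq\mathbb{F}1$. For a Vidinli algebra $A$ with norm $q$ over a field of characteristic not $2$, let $\omega\colon A\times A\to\mathbb{F}$ be the skew-symmetric bilinear form with $[x,y]=\omega(x,y)1$. The associated bilinear form of the Vidinli algebra is $B\colon A\times A\to\mathbb{F}$, $B(x,y)=\frac12\bigl(q(x,y)-\omega(x,y)\bigr)$. Moreover $A=\mathbb{F}1\oplus V$. With $(x,y,z)=(xy)z-x(yz)$ the associator: the commutative center is $K(A)=\{x\in A\mid xy=yx\ \forall y\in A\}$; the (associative) nucleus is $N(A)=\{x\in A\mid (x,y,z)=(z,x,y)=(y,z,x)=0\ \forall y,z\in A\}$; the center is $Z(A)=N(A)\cap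 K(A)$. *)

theory Defs
  imports Complex_Main
begin

text \<open>Nonassociative algebras live on a whole type \<open>'a\<close>, with scalars from a field type \<open>'f\<close>.  The
  multiplication and the unity are explicit parameters, because the multiplicative type classes
  of the library are associative.\<close>

definition bilinear_on ::
  "('f::field \<Rightarrow> 'a::ab_group_add \<Rightarrow> 'a) \<Rightarrow> ('f \<Rightarrow> 'b::ab_group_add \<Rightarrow> 'b) \<Rightarrow> ('a \<Rightarrow> 'a \<Rightarrow> 'b) \<Rightarrow> bool"
  where "bilinear_on s t f \<longleftrightarrow>
    (\<forall>x. Vector_Spaces.linear s t (\<lambda>y. f x y)) \<and> (\<forall>y. Vector_Spaces.linear s t (\<lambda>x. f x y))"

definition polar :: "('a::ab_group_add \<Rightarrow> 'f::ab_group_add) \<Rightarrow> 'a \<Rightarrow> 'a \<Rightarrow> 'f"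
  where "polar q x y = q (x + y) - q x - q y"

definition quadratic_form :: "('f::field \<Rightarrow> 'a::ab_group_add \<Rightarrow> 'a) \<Rightarrow> ('a \<Rightarrow> 'f) \<Rightarrow> bool"
  where "quadratic_form s q \<longleftrightarrow>
    (\<forall>c x. q (s c x) = c\<^sup>2 * q x) \<and> bilinear_on s (*) (polar q)"

definition commutator :: "('a::ab_group_add \<Rightarrow> 'a \<Rightarrow> 'a) \<Rightarrow> 'a \<Rightarrow> 'a \<Rightarrow> 'a"
  where "commutator mul x y = mul x y - mul y x"

definition associator :: "('a::ab_group_add \<Rightarrow> 'a \<Rightarrow> 'a) \<Rightarrow> 'a \<Rightarrow> 'a \<Rightarrow> 'a \<Rightarrow> 'a"
  where "associator mul x y z = mul (mul x y) z - mul x (mul y z)"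

definition commutative_center :: "('a \<Rightarrow> 'a \<Rightarrow> 'a) \<Rightarrow> 'a set"
  where "commutative_center mul = {x. \<forall>y. mul x y = mul y x}"

definition nucleus :: "('a::ab_group_add \<Rightarrow> 'a \<Rightarrow> 'a) \<Rightarrow> 'a set"
  where "nucleus mul = {x. \<forall>y z. associator mul x y z = 0 \<and> associator mul z x y = 0 \<and>
    associator mul y z x = 0}"

definition center :: "('a::ab_group_add \<Rightarrow> 'a \<Rightarrow> 'a) \<Rightarrow> 'a set"
  where "center mul = nucleus mul \<inter> commutative_center mul"

definition scalars :: "('f \<Rightarrow> 'a \<Rightarrow> 'a) \<Rightarrow> 'a \<Rightarrow> 'a set"
  where "scalars s e = range (\<lambda>c. s c e)"

locale unital_algebra = vector_space scale
  for scale :: "'f::field \<Rightarrow> 'a::ab_group_add \<Rightarrow> 'a" +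
  fixes mul :: "'a \<Rightarrow> 'a \<Rightarrow> 'a" and e :: 'a
  assumes bilinear_mul: "bilinear_on scale scale mul"
    and unit_left: "mul e x = x"
    and unit_right: "mul x e = x"

locale conic_algebra = unital_algebra scale mul e
  for scale :: "'f::field \<Rightarrow> 'a::ab_group_add \<Rightarrow> 'a" and mul :: "'a \<Rightarrow> 'a \<Rightarrow> 'a" and e :: 'a +
  fixes q :: "'a \<Rightarrow> 'f"
  assumes quadratic_form_norm: "quadratic_form scale q"
    and norm_unit: "q e = 1"
    and conic: "mul x x - scale (polar q x e) x + scale (q x) e = 0"

locale vidinli_algebra = conic_algebra scale mul e q
  for scale :: "'f::field \<Rightarrow> 'a::ab_group_add \<Rightarrow> 'a" and mul :: "'a \<Rightarrow> 'a \<Rightarrow> 'a" and e :: 'a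
    and q :: "'a \<Rightarrow> 'f" +
  assumes commutator_scalar: "commutator mul x y \<in> scalars scale e"

text \<open>The definite description below is meaningful in every Vidinli algebra: the lemmas
  \<open>commutator_eq_omega\<close>, \<open>omega_unique\<close> and \<open>bilinear_omega\<close> identify it with the form
  \<open>\<omega>\<close> for which \<open>[x,y] = \<omega>(x,y)1\<close>.\<close>

definition omega :: "('f::field \<Rightarrow> 'a::ab_group_add \<Rightarrow> 'a) \<Rightarrow> ('a \<Rightarrow> 'a \<Rightarrow> 'a) \<Rightarrow> 'a \<Rightarrow> 'a \<Rightarrow> 'a \<Rightarrow> 'f"
  where "omega s mul e x y = (THE c. commutator mul x y = s c e)"

definition assoc_form ::
  "('f::field \<Rightarrow> 'a::ab_group_add \<Rightarrow> 'a) \<Rightarrow> ('a \<Rightarrow> 'a \<Rightarrow> 'a) \<Rightarrow> 'a \<Rightarrow> ('a \<Rightarrow> 'f) \<Rightarrow> 'a \<Rightarrow> 'a \<Rightarrow> 'f"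
  where "assoc_form s mul e q x y = (1 / 2) * (polar q x y - omega s mul e x y)"

definition trace_zero :: "'a::ab_group_add \<Rightarrow> ('a \<Rightarrow> 'f::field) \<Rightarrow> 'a set"
  where "trace_zero e q = {x. polar q x e = 0}"

context vidinli_algebra
begin

lemma unit_nonzero: "e \<noteq> 0"
proof
  assume "e = 0"
  then have "q e = q (scale 0 e)" by simp
  also have "\<dots> = 0\<^sup>2 * q e" using quadratic_form_norm by (simp only: quadratic_form_def)
  finally show False using norm_unit by simp
qed

lemma scale_unit_cancel: "scale c e = scale d e \<longleftrightarrow> c = d"
  using unit_nonzero by simp

lemma omega_unique: "commutator mul x y = scale c e \<Longrightarrow> omega scale mul e x y = c"
  unfolding omega_def by (rule the_equality) (auto simp: unit_nonzero)

lemma commutator_eq_omega: "commutator mul x y = scale (omega scale mul e x y) e"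
  using commutator_scalar[of x y] omega_unique by (auto simp: scalars_def)

lemma omega_skew: "omega scale mul e y x = - omega scale mul e x y"
proof (rule omega_unique)
  have "commutator mul y x = - commutator mul x y" by (simp add: commutator_def)
  then show "commutator mul y x = scale (- omega scale mul e x y) e"
    by (simp add: commutator_eq_omega)
qed

lemma mul_add_scale:
  "mul (x + y) z = mul x z + mul y z" "mul z (x + y) = mul z x + mul z y"
  "mul (scale c x) z = scale c (mul x z)" "mul z (scale c x) = scale c (mul z x)"
  using bilinear_mul unfolding bilinear_on_def
  by (auto simp: Vector_Spaces.linear_iff)

lemma bilinear_omega: "bilinear_on scale (*) (omega scale mul e)"
proof -
  interpret field_vs: vector_space "(*) :: 'f \<Rightarrow> 'f \<Rightarrow> 'f"
    by unfold_locales (auto simp: algebra_simps)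
  have add: "omega scale mul e (x + y) z = omega scale mul e x z + omega scale mul e y z" for x y z
    by (rule omega_unique)
      (simp add: scale_left_distrib commutator_eq_omega[symmetric] commutator_def mul_add_scale)
  have scl: "omega scale mul e (scale c x) z = c * omega scale mul e x z" for c x z
    by (rule omega_unique)
      (simp add: scale_scale[symmetric] commutator_eq_omega[symmetric] commutator_def mul_add_scale
        scale_right_diff_distrib del: scale_scale)
  have "Vector_Spaces.linear scale (*) (\<lambda>x. omega scale mul e x y)" for y
    by unfold_locales (auto simp: add scl)
  moreover have "Vector_Spaces.linear scale (*) (\<lambda>y. omega scale mul e x y)" for x
    by unfold_locales (auto simp: omega_skew[of x] add scl)
  ultimately show ?thesis by (simp add: bilinear_on_def)
qed

end

end

theory Submission
  imports Defs
begin

text \<open>Write \<open>V\<close> for the trace-zero space.  Linearizing the conic identity gives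
  \<open>uv + vu = -q(u,v)1\<close> on \<open>V\<close>; together with \<open>uv - vu = \<omega>(u,v)1\<close> this says that
  \<open>uv = -B(u,v)1\<close> for \<open>u, v \<in> V\<close>.  The algebra \<open>\<F>1 \<oplus> V\<close> is thus completely described by \<open>B\<close>.
  An associator is unchanged when scalars are added to its arguments, so all associators reduce to
  \<open>(u,v,w) = B(v,w)u - B(u,v)w\<close> with \<open>u, v, w \<in> V\<close>.

  Suppose that the nucleus is larger than \<open>\<F>1\<close>.  Since it is stable under adding scalars, it then
  contains some \<open>n \<noteq> 0\<close> in \<open>V\<close>.  If some \<open>w \<in> V\<close> is not a multiple of \<open>n\<close>, then
  \<open>(n,v,w) = 0\<close> forces \<open>B(n,v) = 0\<close> for all \<open>v\<close>, and with this \<open>(n,v,w') = 0\<close> becomes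
  \<open>B(v,w')n = 0\<close> for all \<open>v, w' \<in> V\<close>, so \<open>B\<close> vanishes on \<open>V\<close>.  Otherwise
  \<open>V = \<F>n\<close> and \<open>1, n\<close> is a basis of the algebra.  This is the trichotomy.

  Conversely, if \<open>B\<close> vanishes on \<open>V\<close> then so do all products of elements of \<open>V\<close>, and if the
  dimension is two then, up to scalars, all elements are multiples of a single \<open>f\<close>.  In both cases
  the commutators and associators, which ignore scalars, vanish.\<close>

lemma two_neq_zero_if_CHAR_neq_2:
  assumes "CHAR('f::field) \<noteq> 2"
  shows "(2::'f) \<noteq> 0"
proof
  assume "(2::'f) = 0"
  then have "of_nat 2 = (0::'f)" by simp
  then have "CHAR('f) dvd 2" by (simp only: of_nat_eq_0_iff_char_dvd)
  then have "CHAR('f) \<le> 2" "CHAR('f) \<noteq> 0" by (auto dest: dvd_imp_le intro: Nat.gr0I)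
  with assms CHAR_not_1' show False by (metis One_nat_def le_SucE numeral_2_eq_2 le_zero_eq)
qed

context unital_algebra
begin

lemma mul_add: "mul (x + y) z = mul x z + mul y z" "mul z (x + y) = mul z x + mul z y"
  and mul_scale: "mul (scale c x) z = scale c (mul x z)" "mul z (scale c x) = scale c (mul z x)"
  using bilinear_mul unfolding bilinear_on_def by (auto simp: Vector_Spaces.linear_iff)

lemma mul_add_scalars:
  "mul (scale a e + u) (scale b e + v) =
    scale (a * b) e + scale a v + scale b u + mul u v"
  by (simp add: mul_add mul_scale unit_left unit_right algebra_simps)

text \<open>The associator is additive in each argument and vanishes as soon as one argument is a scalar.\<close>

lemma associator_add_scalars:
  "associator mul (scale a e + u) (scale b e + v) (scale c e + w) = associator mul u v w"
  by (simp add: associator_def mul_add mul_scale unit_left unit_right algebra_simps)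

lemma scalar_in_nucleus: "scale a e \<in> nucleus mul"
  by (simp add: nucleus_def associator_def mul_scale unit_left unit_right)

lemma scalar_in_commutative_center: "scale a e \<in> commutative_center mul"
  by (simp add: commutative_center_def mul_scale unit_left unit_right)

lemma dim_eq_2_iff_span_unit_pair:
  assumes "e \<noteq> 0"
  shows "dim (UNIV :: 'a set) = 2 \<longleftrightarrow> (\<exists>f. f \<notin> span {e} \<and> span {e, f} = UNIV)"
proof
  assume dim2: "dim (UNIV :: 'a set) = 2"
  have "independent {e}" using assms by simp
  then obtain S where S: "{e} \<subseteq> S" "independent S" "UNIV \<subseteq> span S"
    by (metis maximal_independent_subset_extend subset_UNIV)
  then have "card S = 2" using dim2 by (metis basis_card_eq_dim subset_UNIV)
  then obtain f where f: "S = {e, f}" "f \<noteq> e"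
    using S(1) by (auto simp: card_2_iff)
  then have "f \<notin> span {e}" using S(2) by (metis independent_insert insertE insert_commute singletonD)
  then show "\<exists>f. f \<notin> span {e} \<and> span {e, f} = UNIV" using S(3) f by auto
next
  assume "\<exists>f. f \<notin> span {e} \<and> span {e, f} = UNIV"
  then obtain f where f: "f \<notin> span {e}" "span {e, f} = UNIV" by blast
  have "independent {f, e}"
    using f(1) assms by (simp add: independent_insert)
  moreover have "f \<noteq> e" using f(1) span_base by blast
  ultimately show "dim (UNIV :: 'a set) = 2"
    using f(2) dim_eq_card[of "{f, e}" UNIV] by (simp add: insert_commute)
qed

lemma span_unit_pair_decomp:
  assumes "span {e, f} = UNIV"
  obtains a b where "x = scale a e + scale b f"
proof -
  have "x \<in> span {e, f}" using assms by simp
  then obtain a where "x - scale a e \<in> span {f}" by (auto simp: span_insert)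
  then obtain b where "x - scale a e = scale b f" by (auto simp: span_singleton)
  then have "x = scale a e + scale b f" by (simp add: algebra_simps)
  then show ?thesis by (rule that)
qed

end

context conic_algebra
begin

lemma polar_add: "polar q (x + y) z = polar q x z + polar q y z"
  and polar_scale: "polar q (scale c x) z = c * polar q x z"
  using quadratic_form_norm unfolding quadratic_form_def bilinear_on_def
  by (auto simp: Vector_Spaces.linear_iff)

lemma polar_unit: "polar q e e = 2"
proof -
  have "q (e + e) = q (scale 2 e)"
    using scale_left_distrib[of 1 1 e] by simp
  also have "\<dots> = 4"
    using quadratic_form_norm by (simp add: quadratic_form_def norm_unit)
  finally show ?thesis by (simp add: polar_def norm_unit)
qed

lemma square: "mul x x = scale (polar q x e) x - scale (q x) e"
  using conic[of x] by (simp add: algebra_simps)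

lemma cube_assoc: "associator mul x x x = 0"
  by (simp add: associator_def square mul_scale mul_add unit_left unit_right
    diff_conv_add_uminus scale_minus_left[symmetric] del: scale_minus_left add_uminus_conv_diff)

lemma trace_zero_add: "u \<in> trace_zero e q \<Longrightarrow> v \<in> trace_zero e q \<Longrightarrow> u + v \<in> trace_zero e q"
  by (simp add: trace_zero_def polar_add)

text \<open>The scalar part is half the trace, because \<open>1\<close> has trace \<open>2\<close>.\<close>

lemma trace_zero_decomp:
  assumes "(2::'f) \<noteq> 0"
  obtains a u where "x = scale a e + u" "u \<in> trace_zero e q"
proof
  let ?a = "polar q x e / 2"
  show "x = scale ?a e + (x + scale (- ?a) e)" by simp
  show "x + scale (- ?a) e \<in> trace_zero e q"
    using assms by (simp add: trace_zero_def polar_add polar_scale polar_unit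
      del: scale_minus_left)
qed

lemma trace_zero_not_scalar:
  assumes "(2::'f) \<noteq> 0" "u \<in> trace_zero e q" "u \<noteq> 0"
  shows "u \<notin> span {e}"
proof
  assume "u \<in> span {e}"
  then obtain a where "u = scale a e" by (auto simp: span_singleton)
  with assms show False by (auto simp: trace_zero_def polar_scale polar_unit)
qed

end

context vidinli_algebra
begin

abbreviation B :: "'a \<Rightarrow> 'a \<Rightarrow> 'f" where "B \<equiv> assoc_form scale mul e q"
abbreviation V :: "'a set" where "V \<equiv> trace_zero e q"

text \<open>The conic identity prescribes the symmetric part of the product on \<open>V\<close>, the commutator
  its skew part; the form \<open>B\<close> combines the two.\<close>

lemma trace_zero_mul:
  assumes two: "(2::'f) \<noteq> 0" and uv: "u \<in> V" "v \<in> V"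
  shows "mul u v = scale (- B u v) e"
proof -
  have sq: "mul x x = scale (- q x) e" if "x \<in> V" for x
    using square[of x] that by (simp add: trace_zero_def)
  have "mul u v + mul v u = mul (u + v) (u + v) - mul u u - mul v v"
    by (simp add: mul_add)
  also have "\<dots> = scale (- polar q u v) e"
    using uv by (simp add: sq trace_zero_add polar_def algebra_simps)
  finally have sym: "mul u v + mul v u = scale (- polar q u v) e" .
  have skew: "mul u v - mul v u = scale (omega scale mul e u v) e"
    using commutator_eq_omega[of u v] by (simp add: commutator_def)
  have "scale 2 (mul u v) = (mul u v + mul v u) + (mul u v - mul v u)"
    using scale_left_distrib[of 1 1 "mul u v"] by simp
  also have "\<dots> = scale (- polar q u v + omega scale mul e u v) e"
    unfolding sym skew by (simp only: scale_left_distrib)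
  also have "- polar q u v + omega scale mul e u v = 2 * (- B u v)"
    using two by (simp add: assoc_form_def field_simps)
  also have "scale (2 * (- B u v)) e = scale 2 (scale (- B u v) e)" by simp
  finally show ?thesis using two scale_cancel_left by blast
qed

lemma trace_zero_associator:
  assumes "(2::'f) \<noteq> 0" "u \<in> V" "v \<in> V" "w \<in> V"
  shows "associator mul u v w = scale (B v w) u - scale (B u v) w"
  using assms by (simp add: associator_def trace_zero_mul mul_scale unit_left unit_right
    del: scale_minus_left) simp

text \<open>For \<open>n\<close> in the nucleus and in \<open>V\<close>, the condition \<open>(n,v,w) = 0\<close> reads
  \<open>B(v,w)n = B(n,v)w\<close>.  Either \<open>V\<close> is the line through \<open>n\<close>, or comparing both sides for some
  \<open>w\<close> off that line makes \<open>B(n,v)\<close>, and hence \<open>B\<close>, vanish.\<close>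

lemma nucleus_nonscalar_cases:
  assumes two: "(2::'f) \<noteq> 0" and x: "x \<in> nucleus mul" "x \<notin> scalars scale e"
  shows "(\<forall>u\<in>V. \<forall>v\<in>V. B u v = 0) \<or> dim (UNIV :: 'a set) = 2"
proof -
  obtain a n where n: "x = scale a e + n" "n \<in> V"
    using trace_zero_decomp[OF two] by blast
  have n0: "n \<noteq> 0" using x(2) n(1) by (auto simp: scalars_def)
  have nuc: "scale (B v w) n = scale (B n v) w" if "v \<in> V" "w \<in> V" for v w
  proof -
    have "associator mul n v w = associator mul x v w"
      using associator_add_scalars[of a n 0 v 0 w] n(1) by simp
    also have "\<dots> = 0" using x(1) by (simp add: nucleus_def)
    finally show ?thesis using trace_zero_associator[OF two n(2) that] by simp
  qed
  show ?thesis
  proof (cases "V \<subseteq> span {n}")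
    case True
    have "y \<in> span {e, n}" for y
    proof -
      obtain b u where y: "y = scale b e + u" "u \<in> V"
        using trace_zero_decomp[OF two] by blast
      have "u \<in> span {e, n}"
        using True y(2) span_mono[of "{n}" "{e, n}"] by blast
      then show ?thesis
        unfolding y(1) by (intro span_add span_scale) (auto intro: span_base)
    qed
    then show ?thesis
      using dim_eq_2_iff_span_unit_pair[OF unit_nonzero] trace_zero_not_scalar[OF two n(2) n0]
      by blast
  next
    case False
    then obtain w where w: "w \<in> V" "w \<notin> span {n}" by blast
    have Bn: "B n v = 0" if v: "v \<in> V" for v
    proof (rule ccontr)
      assume nz: "B n v \<noteq> 0"
      have "w = scale (inverse (B n v)) (scale (B n v) w)" using nz by simp
      also have "\<dots> = scale (inverse (B n v) * B v w) n"
        by (simp flip: nuc[OF v w(1)])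
      finally show False using w(2) by (auto simp: span_singleton)
    qed
    have "B u v = 0" if "u \<in> V" "v \<in> V" for u v
      using nuc[OF that] Bn[OF that(1)] n0 by simp
    then show ?thesis by blast
  qed
qed

lemma commutative_associative_if_form_zero:
  assumes two: "(2::'f) \<noteq> 0" and B0: "\<forall>u\<in>V. \<forall>v\<in>V. B u v = 0"
  shows "mul x y = mul y x" "associator mul x y z = 0"
proof -
  obtain a u b v c w where
    "x = scale a e + u" "y = scale b e + v" "z = scale c e + w" and V: "u \<in> V" "v \<in> V" "w \<in> V"
    by (metis trace_zero_decomp[OF two])
  note decomp = this(1-3)
  show "mul x y = mul y x"
    unfolding decomp mul_add_scalars using V B0
    by (simp add: trace_zero_mul[OF two] algebra_simps)
  show "associator mul x y z = 0"
    unfolding decomp associator_add_scalars using V B0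
    by (simp add: trace_zero_associator[OF two])
qed

end

text \<open>A two-dimensional conic algebra is the quadratic algebra generated by one element \<open>f\<close>, and
  \<open>f\<close> commutes with itself and associates with itself because \<open>f\<^sup>2\<close> lies in the span of
  \<open>1\<close> and \<open>f\<close>.\<close>

lemma (in conic_algebra) commutative_associative_if_dim_2:
  assumes "e \<noteq> 0" and "dim (UNIV :: 'a set) = 2"
  shows "mul x y = mul y x" "associator mul x y z = 0"
proof -
  obtain f where f: "span {e, f} = UNIV"
    using dim_eq_2_iff_span_unit_pair assms by blast
  obtain a a' b b' c c' where decomp:
    "x = scale a e + scale a' f" "y = scale b e + scale b' f" "z = scale c e + scale c' f"
    by (metis span_unit_pair_decomp[OF f])
  show "mul x y = mul y x"
    unfolding decomp mul_add_scalars by (simp add: mul_scale algebra_simps)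
  have "associator mul (scale a' f) (scale b' f) (scale c' f)
      = scale (a' * b' * c') (associator mul f f f)"
    by (simp add: associator_def mul_scale scale_right_diff_distrib ac_simps)
  then show "associator mul x y z = 0"
    unfolding decomp associator_add_scalars by (simp add: cube_assoc)
qed

theorem proposition3p11:
  fixes scale :: "'f::field \<Rightarrow> 'a::ab_group_add \<Rightarrow> 'a"
    and mul :: "'a \<Rightarrow> 'a \<Rightarrow> 'a" and e :: 'a and q :: "'a \<Rightarrow> 'f"
  assumes "vidinli_algebra scale mul e q"
    and "CHAR('f) \<noteq> 2"
  shows "((\<forall>u\<in>trace_zero e q. \<forall>v\<in>trace_zero e q. assoc_form scale mul e q u v = 0) \<or>
          vector_space.dim scale (UNIV :: 'a set) = 2 \<or>
          (center mul = nucleus mul \<and> nucleus mul = scalars scale e)) \<and>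
         ((\<forall>u\<in>trace_zero e q. \<forall>v\<in>trace_zero e q. assoc_form scale mul e q u v = 0) \<or>
          vector_space.dim scale (UNIV :: 'a set) = 2 \<longrightarrow>
          (\<forall>x y. mul x y = mul y x) \<and> (\<forall>x y z. mul (mul x y) z = mul x (mul y z)) \<and>
          center mul = UNIV \<and> nucleus mul = UNIV)"
proof -
  interpret vidinli_algebra scale mul e q by fact
  have two: "(2::'f) \<noteq> 0" using assms(2) by (rule two_neq_zero_if_CHAR_neq_2)
  let ?degenerate = "(\<forall>u\<in>V. \<forall>v\<in>V. B u v = 0) \<or> dim (UNIV :: 'a set) = 2"
  have "center mul = nucleus mul \<and> nucleus mul = scalars scale e" if "\<not> ?degenerate"
  proof -
    have "nucleus mul = scalars scale e"
      using nucleus_nonscalar_cases[OF two] that scalar_in_nucleus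
      by (auto simp: scalars_def)
    then show ?thesis
      using scalar_in_commutative_center by (auto simp: center_def scalars_def)
  qed
  moreover have "(\<forall>x y. mul x y = mul y x) \<and> (\<forall>x y z. mul (mul x y) z = mul x (mul y z)) \<and>
      center mul = UNIV \<and> nucleus mul = UNIV" if "?degenerate"
  proof -
    have comm: "mul x y = mul y x" for x y
      using that commutative_associative_if_form_zero(1)[OF two]
        commutative_associative_if_dim_2(1)[OF unit_nonzero] by blast
    have assoc: "associator mul x y z = 0" for x y z
      using that commutative_associative_if_form_zero(2)[OF two]
        commutative_associative_if_dim_2(2)[OF unit_nonzero] by blast
    have "mul (mul x y) z = mul x (mul y z)" for x y z
      using assoc[of x y z] by (simp add: associator_def)
    moreover have "commutative_center mul = UNIV"
      using comm by (auto simp: commutative_center_def)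
    moreover have "nucleus mul = UNIV"
      using assoc by (simp add: nucleus_def)
    ultimately show ?thesis using comm by (simp add: center_def)
  qed
  ultimately show ?thesis by blast
qed

end
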